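(* Let $\mathbf{U}=\{\mathbf{u}_1,\dots,\mathbf{u}_n\}$ be a set of $n$ user vectors and $\mathbf{P}$ a set of $m$ item vectors in $\mathbb{R}^d$, and let the parameters $\tau$ (number of thresholds), $\omega$ (number of partitions) and $s$ (number of samples per partition) all be $O(1)$. Suppose that for each user the bounds $f_{\min}$ and $f_{\max}$ used to define the thresholds are available in $O(1)$ time. Then the rank-table pre-processing algorithm (described in the context), which outputs the threshold lists and the $n\times\tau$ rank table, runs in $O((n+m)d+m\log m)$ time.
   Context: Cost model: arithmetic operations, comparisons, memory accesses and drawing one random sample take $O(1)$ time, so computing an inner product or a Euclidean norm of $d$-dimensional vectors takes $O(d)$ time. Sorting $m$ numbers takes $O(m\log m)$ time. Pre-processing algorithm on input $\mathbf{U},\mathbf{P},\tau,\omega,s$: (1) Compute the Euclidean norm $\|\mathbf{p}\|$ of every $\mathbf{p}\in\mathbf{P}$, sort $\mathbf{P}$ in descending order of norm, and partition the sorted list into $\omega$ disjoint equally-sized consecutive buckets $\mathbf{P}_1,\dots,\mathbf{P}_\omega$. For each $l\in\{1,\dots,\omega\}$, draw a set $\mathbf{P}^{sample}_l$ of $s$ random samples from $\mathbf{P}_l$. (2) For each user $\mathbf{u}_i$, compute the thresholds $t_{\mathbf{u}_i,j}=f_{\min}+(j-1)\frac{f_{\max}-f_{\min}}{\tau-1}$ for $j=1,\dots,\tau$ (with $\tau\ge 2$), where $f_{\min}\le f_{\max}$ are the minimum and maximum domain values of the inner products (used in place of $\min_{\mathbf{p}\in\mathbf{P}}\mathbf{u}_i\cdot\mathbf{p}$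 and $\max_{\mathbf{p}\in\mathbf{P}}\mathbf{u}_i\cdot\mathbf{p}$). (3) For each user $\mathbf{u}_i$ and each $j\in\{1,\dots,\tau\}$, compute the rank table entry $$\hat{\mathcal{T}}_{i,j}=1+\sum_{l=1}^{\omega}\frac{|\mathbf{P}_l|\cdot|\{\mathbf{p}\in\mathbf{P}^{sample}_l:\mathbf{u}_i\cdot\mathbf{p}>t_{\mathbf{u}_i,j}\}|}{s},$$ by computing the inner product of $\mathbf{u}_i$ with each sampled item once and, for each sampled item $\mathbf{p}$, scanning $j=1,2,\dots$ in order and incrementing the $j$-th counter until the first $j$ with $\mathbf{u}_i\cdot\mathbf{p}\le t_{\mathbf{u}_i,j}$. *)

theory Defs
  imports
    "HOL-Probability.Probability_Mass_Function"
    "HOL-Library.Landau_Symbols"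
    "Jordan_Normal_Form.Matrix"
begin

text \<open>Vectors of \<open>\<real>\<^sup>d\<close> are elements of \<^term>\<open>carrier_vec d\<close>, so that \<open>d\<close> is a term
  and the constant of the running-time bound cannot depend on it.\<close>

type_synonym rvec = "real Matrix.vec"

definition vnorm :: "rvec \<Rightarrow> real" where
  "vnorm v = sqrt (scalar_prod v v)"


section \<open>Cost model\<close>

text \<open>A randomized computation is a distribution over pairs of a result and the time spent on
  the run that produced it. Arithmetic operations (including square roots), comparisons, memory
  accesses (reads and writes, also random access into an array, which is modelled as a list) and
  the drawing of one random sample have arbitrary but fixed costs; sorting is a primitive whose
  cost depends on the number of keys.\<close>

record cost_model =
  arith_cost :: nat
  cmp_cost :: nat
  mem_cost :: nat
  draw_cost :: nat
  sort_cost :: "nat \<Rightarrow> nat"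

type_synonym 'a timed = "('a \<times> nat) pmf"

definition ret :: "'a \<Rightarrow> 'a timed" where
  "ret x = return_pmf (x, 0)"

definition charge :: "nat \<Rightarrow> 'a \<Rightarrow> 'a timed" where
  "charge c x = return_pmf (x, c)"

definition tbind :: "'a timed \<Rightarrow> ('a \<Rightarrow> 'b timed) \<Rightarrow> 'b timed" (infixl "\<then>" 54) where
  "M \<then> f = bind_pmf M (\<lambda>(x, a). map_pmf (\<lambda>(y, b). (y, a + b)) (f x))"

abbreviation arith :: "cost_model \<Rightarrow> 'a \<Rightarrow> 'a timed" where
  "arith cm \<equiv> charge (arith_cost cm)"

abbreviation compare :: "cost_model \<Rightarrow> bool \<Rightarrow> bool timed" where
  "compare cm \<equiv> charge (cmp_cost cm)"

abbreviation access :: "cost_model \<Rightarrow> 'a \<Rightarrow> 'a timed" where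
  "access cm \<equiv> charge (mem_cost cm)"

text \<open>Every loop iteration pays for fetching the next element, advancing the loop counter and
  testing it; leaving the loop pays for the last test.\<close>

definition iter :: "cost_model \<Rightarrow> 'a \<Rightarrow> 'a timed" where
  "iter cm x = charge (mem_cost cm + arith_cost cm + cmp_cost cm) x"

primrec map_t :: "cost_model \<Rightarrow> ('a \<Rightarrow> 'b timed) \<Rightarrow> 'a list \<Rightarrow> 'b list timed" where
  "map_t cm f [] = charge (cmp_cost cm) []"
| "map_t cm f (x # xs) =
     iter cm x \<then> (\<lambda>x. f x \<then> (\<lambda>y. access cm y \<then> (\<lambda>y.
     map_t cm f xs \<then> (\<lambda>ys. ret (y # ys)))))"

primrec fold_t :: "cost_model \<Rightarrow> ('b \<Rightarrow> 'a \<Rightarrow> 'b timed) \<Rightarrow> 'b \<Rightarrow> 'a list \<Rightarrow> 'b timed" where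
  "fold_t cm f acc [] = charge (cmp_cost cm) acc"
| "fold_t cm f acc (x # xs) =
     iter cm x \<then> (\<lambda>x. f acc x \<then> (\<lambda>acc'. fold_t cm f acc' xs))"


section \<open>Inner products, norms and sorting\<close>

definition inner_t :: "cost_model \<Rightarrow> rvec \<Rightarrow> rvec \<Rightarrow> real timed" where
  "inner_t cm u p = fold_t cm (\<lambda>a k.
       access cm (vec_index u k) \<then> (\<lambda>x.
       access cm (vec_index p k) \<then> (\<lambda>y.
       arith cm (x * y) \<then> (\<lambda>z.
       arith cm (a + z)))))
     0 [0..<dim_vec p]"

definition norm_t :: "cost_model \<Rightarrow> rvec \<Rightarrow> real timed" where
  "norm_t cm p = inner_t cm p p \<then> (\<lambda>q. arith cm (sqrt q))"

definition sort_desc_t :: "cost_model \<Rightarrow> (real \<times> 'a) list \<Rightarrow> (real \<times> 'a) list timed" where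
  "sort_desc_t cm xs = charge (sort_cost cm (length xs)) (sort_key (\<lambda>x. - fst x) xs)"


section \<open>Step 1: partitioning and sampling\<close>

text \<open>Bucket \<open>l\<close> holds the positions \<open>\<lfloor>l m / \<omega>\<rfloor>, \<dots>, \<lfloor>(l + 1) m / \<omega>\<rfloor> - 1\<close> of the sorted
  list. All buckets have size \<open>m / \<omega>\<close> if \<open>\<omega>\<close> divides \<open>m\<close>; otherwise their sizes differ by at
  most one.\<close>

definition bucket_t :: "cost_model \<Rightarrow> 'a list \<Rightarrow> nat \<Rightarrow> nat \<Rightarrow> 'a list timed" where
  "bucket_t cm xs \<omega> l =
     access cm (length xs) \<then> (\<lambda>m.
     arith cm (l * m) \<then> (\<lambda>a.
     arith cm (a div \<omega>) \<then> (\<lambda>lo.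
     arith cm (l + 1) \<then> (\<lambda>l'.
     arith cm (l' * m) \<then> (\<lambda>b.
     arith cm (b div \<omega>) \<then> (\<lambda>hi.
     map_t cm (\<lambda>i. access cm (xs ! i)) [lo..<hi]))))))"

definition partition_t :: "cost_model \<Rightarrow> rvec list \<Rightarrow> nat \<Rightarrow> rvec list list timed" where
  "partition_t cm ps \<omega> =
     map_t cm (\<lambda>p. norm_t cm p \<then> (\<lambda>r. ret (r, p))) ps \<then> (\<lambda>keyed.
     sort_desc_t cm keyed \<then> (\<lambda>sorted_keyed.
     map_t cm (\<lambda>x. ret (snd x)) sorted_keyed \<then> (\<lambda>sorted_ps.
     map_t cm (bucket_t cm sorted_ps \<omega>) [0..<\<omega>])))"

text \<open>The samples of a bucket are drawn uniformly, either independently or among the items of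
  the bucket that were not drawn before.\<close>

datatype sampling = With_Replacement | Without_Replacement

definition draw_t :: "cost_model \<Rightarrow> sampling \<Rightarrow> 'a list \<Rightarrow> 'a list \<Rightarrow> 'a timed" where
  "draw_t cm mode B drawn =
     map_pmf (\<lambda>p. (p, draw_cost cm))
       (pmf_of_set (case mode of With_Replacement \<Rightarrow> set B
                               | Without_Replacement \<Rightarrow> set B - set drawn))"

definition samples_t :: "cost_model \<Rightarrow> sampling \<Rightarrow> nat \<Rightarrow> 'a list \<Rightarrow> 'a list timed" where
  "samples_t cm mode s B = fold_t cm (\<lambda>drawn _.
       draw_t cm mode B drawn \<then> (\<lambda>p.
       access cm p \<then> (\<lambda>p. ret (p # drawn))))
     [] [0..<s]"


section \<open>Step 2: thresholds\<close>

text \<open>\<open>fmin u\<close> and \<open>fmax u\<close> are the bounds for user \<open>u\<close>; obtaining them takes time \<open>ftime u\<close>.\<close>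

definition thresholds_t ::
  "cost_model \<Rightarrow> (rvec \<Rightarrow> real) \<Rightarrow> (rvec \<Rightarrow> real) \<Rightarrow> (rvec \<Rightarrow> nat) \<Rightarrow> nat \<Rightarrow> rvec \<Rightarrow> real list timed"
where
  "thresholds_t cm fmin fmax ftime \<tau> u =
     charge (ftime u) (fmin u, fmax u) \<then> (\<lambda>(lo, hi).
     map_t cm (\<lambda>j.
       arith cm (real j - 1) \<then> (\<lambda>j'.
       arith cm (hi - lo) \<then> (\<lambda>w.
       arith cm (real \<tau> - 1) \<then> (\<lambda>k.
       arith cm (w / k) \<then> (\<lambda>q.
       arith cm (j' * q) \<then> (\<lambda>x.
       arith cm (lo + x))))))) [1..<\<tau> + 1])"


section \<open>Step 3: rank table\<close>

text \<open>The first list contains the thresholds, the second one the counters; the scan stops at the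
  first threshold that is not exceeded by \<open>x\<close>.\<close>

fun scan_t :: "cost_model \<Rightarrow> real \<Rightarrow> real list \<Rightarrow> nat list \<Rightarrow> nat list timed" where
  "scan_t cm x (t # ts) (c # cs) =
     iter cm t \<then> (\<lambda>t.
     compare cm (x > t) \<then> (\<lambda>b.
     if b then
       access cm c \<then> (\<lambda>c.
       arith cm (c + 1) \<then> (\<lambda>c'.
       access cm c' \<then> (\<lambda>c'.
       scan_t cm x ts cs \<then> (\<lambda>cs'. ret (c' # cs')))))
     else ret (c # cs)))"
| "scan_t cm x _ cs = charge (cmp_cost cm) cs"

definition counts_t :: "cost_model \<Rightarrow> rvec \<Rightarrow> real list \<Rightarrow> rvec list \<Rightarrow> nat list timed" where
  "counts_t cm u ts S =
     map_t cm (\<lambda>_. ret 0) ts \<then> (\<lambda>zeros.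
     fold_t cm (\<lambda>cs p. inner_t cm u p \<then> (\<lambda>x. scan_t cm x ts cs)) zeros S)"

text \<open>A row of the table starts with all entries \<open>1\<close>; every bucket of size \<open>size_l\<close> then adds
  its contribution \<open>size_l * c / s\<close> to the entry whose counter is \<open>c\<close>.\<close>

definition row_t :: "cost_model \<Rightarrow> nat \<Rightarrow> rvec list list \<Rightarrow> rvec list list \<Rightarrow> rvec \<Rightarrow> real list
    \<Rightarrow> real list timed" where
  "row_t cm s Bs Ss u ts =
     map_t cm (\<lambda>_. ret 1) ts \<then> (\<lambda>ones.
     fold_t cm (\<lambda>row l.
       access cm (length (Bs ! l)) \<then> (\<lambda>size_l.
       access cm (Ss ! l) \<then> (\<lambda>S.
       counts_t cm u ts S \<then> (\<lambda>cs.
       map_t cm (\<lambda>j.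
         access cm (row ! j) \<then> (\<lambda>r.
         access cm (cs ! j) \<then> (\<lambda>c.
         arith cm (real size_l * real c) \<then> (\<lambda>y.
         arith cm (y / real s) \<then> (\<lambda>z.
         arith cm (r + z)))))) [0..<length ts]))))
     ones [0..<length Bs])"

definition preprocess_t ::
  "cost_model \<Rightarrow> sampling \<Rightarrow> (rvec \<Rightarrow> real) \<Rightarrow> (rvec \<Rightarrow> real) \<Rightarrow> (rvec \<Rightarrow> nat)
    \<Rightarrow> rvec list \<Rightarrow> rvec list \<Rightarrow> nat \<Rightarrow> nat \<Rightarrow> nat \<Rightarrow> (real list list \<times> real list list) timed"
where
  "preprocess_t cm mode fmin fmax ftime us ps \<tau> \<omega> s =
     partition_t cm ps \<omega> \<then> (\<lambda>Bs.
     map_t cm (samples_t cm mode s) Bs \<then> (\<lambda>Ss.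
     map_t cm (thresholds_t cm fmin fmax ftime \<tau>) us \<then> (\<lambda>Ts.
     map_t cm (\<lambda>i.
       access cm (us ! i) \<then> (\<lambda>u.
       access cm (Ts ! i) \<then> (\<lambda>ts.
       row_t cm s Bs Ss u ts))) [0..<length us] \<then> (\<lambda>table.
     ret (Ts, table)))))"


section \<open>Specification of the output\<close>

definition threshold :: "real \<Rightarrow> real \<Rightarrow> nat \<Rightarrow> nat \<Rightarrow> real" where
  "threshold lo hi \<tau> j = lo + (real j - 1) * ((hi - lo) / (real \<tau> - 1))"

definition is_norm_partition :: "rvec list \<Rightarrow> nat \<Rightarrow> rvec list list \<Rightarrow> bool" where
  "is_norm_partition ps \<omega> Bs \<longleftrightarrow>
     length Bs = \<omega> \<and>
     mset (concat Bs) = mset ps \<and>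
     sorted_wrt (\<lambda>p q. vnorm p \<ge> vnorm q) (concat Bs) \<and>
     (\<forall>B \<in> set Bs. \<forall>B' \<in> set Bs. length B \<le> length B' + 1) \<and>
     (\<omega> dvd length ps \<longrightarrow> (\<forall>B \<in> set Bs. length B = length ps div \<omega>))"

definition are_samples :: "sampling \<Rightarrow> nat \<Rightarrow> rvec list list \<Rightarrow> rvec list list \<Rightarrow> bool" where
  "are_samples mode s Bs Ss \<longleftrightarrow>
     length Ss = length Bs \<and>
     (\<forall>l < length Bs. length (Ss ! l) = s \<and> set (Ss ! l) \<subseteq> set (Bs ! l) \<and>
        (mode = Without_Replacement \<longrightarrow> distinct (Ss ! l)))"

text \<open>Samples are counted with multiplicity, which matters only for sampling with
  replacement.\<close>

definition rank_entry :: "nat \<Rightarrow> rvec list list \<Rightarrow> rvec list list \<Rightarrow> rvec \<Rightarrow> real \<Rightarrow> real" where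
  "rank_entry s Bs Ss u t =
     1 + (\<Sum>l<length Bs. real (length (Bs ! l))
            * real (length (filter (\<lambda>p. scalar_prod u p > t) (Ss ! l))) / real s)"

text \<open>Lists are indexed from \<open>0\<close>, thresholds from \<open>1\<close>.\<close>

definition is_rank_table_output ::
  "sampling \<Rightarrow> (rvec \<Rightarrow> real) \<Rightarrow> (rvec \<Rightarrow> real) \<Rightarrow> rvec list \<Rightarrow> rvec list
    \<Rightarrow> nat \<Rightarrow> nat \<Rightarrow> nat \<Rightarrow> real list list \<Rightarrow> real list list \<Rightarrow> bool"
where
  "is_rank_table_output mode fmin fmax us ps \<tau> \<omega> s Ts table \<longleftrightarrow>
     length Ts = length us \<and> length table = length us \<and>
     (\<forall>i < length us. length (Ts ! i) = \<tau> \<and> length (table ! i) = \<tau>) \<and>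
     (\<forall>i < length us. \<forall>j \<in> {1..\<tau>}.
        Ts ! i ! (j - 1) = threshold (fmin (us ! i)) (fmax (us ! i)) \<tau> j) \<and>
     (\<exists>Bs Ss. is_norm_partition ps \<omega> Bs \<and> are_samples mode s Bs Ss \<and>
        (\<forall>i < length us. \<forall>j \<in> {1..\<tau>}.
           table ! i ! (j - 1) =
             rank_entry s Bs Ss (us ! i) (threshold (fmin (us ! i)) (fmax (us ! i)) \<tau> j)))"

end

theory Submission
  imports Defs
begin

text \<open>A weakest-precondition style predicate \<open>runs_within M t Q\<close>, asserting that every run of \<open>M\<close>
  takes time at most \<open>t\<close> and ends in a result satisfying \<open>Q\<close>, composes along sequencing and loops,
  so correctness and running time are proved together. The early exit of the scan is harmless
  because the thresholds increase. Only \<open>\<omega> s = O(1)\<close> inner products are computed per user and one norm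
  per item, all of them in time \<open>O(d)\<close>; everything else but sorting is \<open>O(n + m)\<close>.\<close>

text \<open>Without this, \<open>M \<then> f\<close> also parses as the sequencing of \<^theory>\<open>HOL-Library.Monad_Syntax\<close>.\<close>

no_syntax
  "_thenM" :: "['a, 'b] \<Rightarrow> 'c"  (infixl \<open>\<then>\<close> 54)

section \<open>Bounding the time and the result of every run\<close>

definition runs_within :: "'a timed \<Rightarrow> nat \<Rightarrow> ('a \<Rightarrow> bool) \<Rightarrow> bool" where
  "runs_within M t Q \<longleftrightarrow> (\<forall>(x, a) \<in> set_pmf M. a \<le> t \<and> Q x)"

lemma runs_within_weaken:
  assumes "runs_within M t P" "t \<le> t'" "\<And>x. P x \<Longrightarrow> Q x"
  shows "runs_within M t' Q"
  using assms unfolding runs_within_def by fastforce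

lemma runs_within_charge [simp]: "runs_within (charge c x) t Q \<longleftrightarrow> c \<le> t \<and> Q x"
  by (simp add: runs_within_def charge_def)

lemma runs_within_ret [simp]: "runs_within (ret x) t Q \<longleftrightarrow> Q x"
  by (simp add: runs_within_def ret_def)

text \<open>Every run of \<open>M \<then> f\<close> consists of a run of \<open>M\<close> followed
  by a run of \<open>f\<close> on its result, and their times add up.\<close>

lemma runs_within_bind:
  assumes "runs_within M a P" "\<And>x. P x \<Longrightarrow> runs_within (f x) b Q" "a + b \<le> t"
  shows "runs_within (M \<then> f) t Q"
  unfolding runs_within_def
proof safe
  fix y :: 'b and e :: nat
  assume "(y, e) \<in> set_pmf (M \<then> f)"
  then obtain x k l where "(x, k) \<in> set_pmf M" "(y, l) \<in> set_pmf (f x)" "e = k + l"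
    by (fastforce simp: tbind_def)
  then have "k \<le> a" "P x" "l \<le> b" "Q y"
    using assms(1,2) unfolding runs_within_def by fastforce+
  then show "e \<le> t" "Q y" using \<open>e = k + l\<close> assms(3) by auto
qed

text \<open>An equivalence, so that rewriting executes straight-line code by deducting each cost
  from the remaining budget. The truncated subtraction \<open>t - c\<close> is sound because
  \<open>c \<le> t\<close> stands next to it.\<close>

lemma runs_within_charge_bind [simp]:
  "runs_within (charge c x \<then> f) t Q \<longleftrightarrow> c \<le> t \<and> runs_within (f x) (t - c) Q"
proof -
  have "set_pmf (charge c x \<then> f) = (\<lambda>(y, b). (y, c + b)) ` set_pmf (f x)"
    by (simp add: charge_def tbind_def bind_return_pmf)
  then have "runs_within (charge c x \<then> f) t Q \<longleftrightarrow>
      (\<forall>(y, b) \<in> set_pmf (f x). c + b \<le> t \<and> Q y)"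
    by (auto simp: runs_within_def)
  \<comment> \<open>The support of a distribution is nonempty; some run of \<open>f x\<close> is
    needed to extract \<open>c \<le> t\<close> from a bound that speaks only of runs.\<close>
  moreover obtain y b where "(y, b) \<in> set_pmf (f x)"
    using set_pmf_not_empty[of "f x"] by fastforce
  ultimately show ?thesis
    unfolding runs_within_def by fastforce
qed

text \<open>A sum instead of a maximum: it bounds every primitive cost and also the overhead
  \<open>iter\<close> of a whole loop round, which adds three of them.\<close>

definition unit_cost :: "cost_model \<Rightarrow> nat" where
  "unit_cost cm = arith_cost cm + cmp_cost cm + mem_cost cm + draw_cost cm"

text \<open>On top of \<open>t\<close>, each element costs one unit for \<open>iter\<close> and one
  for storing the result; the last unit pays for leaving the loop. The postcondition is relational
  because random draws need not give results that are functions of the elements.\<close>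

lemma runs_within_map_t:
  assumes "\<And>x. x \<in> set xs \<Longrightarrow> runs_within (f x) t (R x)"
  shows "runs_within (map_t cm f xs) (length xs * (t + 2 * unit_cost cm) + unit_cost cm)
           (list_all2 R xs)"
  using assms
proof (induction xs)
  case Nil
  then show ?case by (simp add: unit_cost_def)
next
  case (Cons x xs)
  let ?T = "length xs * (t + 2 * unit_cost cm) + unit_cost cm"
  have rest: "runs_within (map_t cm f xs \<then> (\<lambda>ys. ret (y # ys))) ?T (list_all2 R (x # xs))"
    if "R x y" for y
    by (rule runs_within_bind[OF Cons.IH, where b = 0]) (use that Cons.prems in auto)
  have rest': "runs_within (access cm y \<then> (\<lambda>y. map_t cm f xs \<then> (\<lambda>ys. ret (y # ys))))
      (unit_cost cm + ?T) (list_all2 R (x # xs))" if "R x y" for y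
    unfolding runs_within_charge_bind
    by (intro conjI runs_within_weaken[OF rest[OF that]]) (auto simp: unit_cost_def)
  have "runs_within (f x \<then> (\<lambda>y. access cm y \<then> (\<lambda>y. map_t cm f xs \<then> (\<lambda>ys. ret (y # ys)))))
      (t + (unit_cost cm + ?T)) (list_all2 R (x # xs))"
    by (rule runs_within_bind[OF Cons.prems rest' order_refl]) simp
  then show ?case
    by (auto simp: iter_def unit_cost_def elim!: runs_within_weaken)
qed

lemma runs_within_map_t_eq:
  assumes "\<And>x. x \<in> set xs \<Longrightarrow> runs_within (f x) t (\<lambda>y. y = g x)"
    and "length xs * (t + 2 * unit_cost cm) + unit_cost cm \<le> T"
  shows "runs_within (map_t cm f xs) T (\<lambda>ys. ys = map g xs)"
  using runs_within_map_t[OF assms(1)] assms(2)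
  by (rule runs_within_weaken) (auto simp: list_eq_iff_nth_eq list_all2_conv_all_nth)

text \<open>The invariant is indexed by the number of elements already processed.\<close>

lemma runs_within_fold_t:
  assumes "I 0 acc"
    and "\<And>i acc. i < length xs \<Longrightarrow> I i acc \<Longrightarrow> runs_within (f acc (xs ! i)) t (I (Suc i))"
    and "length xs * (t + unit_cost cm) + unit_cost cm \<le> T"
  shows "runs_within (fold_t cm f acc xs) T (I (length xs))"
proof -
  have "runs_within (fold_t cm f acc xs) (length xs * (t + unit_cost cm) + unit_cost cm)
      (I (length xs))"
    using assms(1,2)
  proof (induction xs arbitrary: acc I)
    case Nil
    then show ?case by (simp add: unit_cost_def)
  next
    case (Cons x xs)
    let ?T = "length xs * (t + unit_cost cm) + unit_cost cm"
    have first: "runs_within (f acc x) t (I 1)"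
      using Cons.prems(2)[of 0 acc] Cons.prems(1) by simp
    \<comment> \<open>The tail counts its elements from 0 again, so the induction hypothesis is
      applied to the invariant shifted by one.\<close>
    have rest: "runs_within (fold_t cm f acc' xs) ?T (I (length (x # xs)))" if "I 1 acc'" for acc'
      using Cons.IH[of "\<lambda>i. I (Suc i)" acc'] that Cons.prems(2)[of "Suc _"] by simp
    have "runs_within (f acc x \<then> (\<lambda>acc'. fold_t cm f acc' xs)) (t + ?T) (I (length (x # xs)))"
      using first rest by (rule runs_within_bind) auto
    then show ?case
      by (auto simp: iter_def unit_cost_def elim!: runs_within_weaken)
  qed
  then show ?thesis using assms(3) by (rule runs_within_weaken)
qed

section \<open>Inner products, norms and buckets\<close>

text \<open>The factor 5 is made up of four operations in the body and one unit of loop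
  overhead.\<close>

lemma runs_within_inner_t:
  "runs_within (inner_t cm u p) (5 * unit_cost cm * dim_vec p + unit_cost cm)
     (\<lambda>x. x = scalar_prod u p)"
proof -
  let ?I = "\<lambda>i a. a = (\<Sum>k<i. vec_index u k * vec_index p k)"
  have "runs_within (inner_t cm u p) (5 * unit_cost cm * dim_vec p + unit_cost cm)
      (?I (length [0..<dim_vec p]))"
    unfolding inner_t_def
    by (rule runs_within_fold_t[where t = "4 * unit_cost cm"]) (auto simp: unit_cost_def algebra_simps)
  then show ?thesis by (simp add: scalar_prod_def atLeast0LessThan)
qed

lemma runs_within_norm_t:
  "runs_within (norm_t cm p) (5 * unit_cost cm * dim_vec p + 2 * unit_cost cm) (\<lambda>x. x = vnorm p)"
  unfolding norm_t_def
  by (rule runs_within_bind[OF runs_within_inner_t, where b = "unit_cost cm"])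
     (auto simp: vnorm_def unit_cost_def)

definition bucket :: "'a list \<Rightarrow> nat \<Rightarrow> nat \<Rightarrow> 'a list" where
  "bucket xs \<omega> l = map ((!) xs) [l * length xs div \<omega>..<(l + 1) * length xs div \<omega>]"

text \<open>Adding \<open>length xs\<close> to \<open>l * length xs\<close> raises the quotient by
  \<open>length xs div \<omega>\<close> plus the carry \<open>?r\<close> of the two remainders. The
  carry is 0 or 1, and it is 0 if \<omega> divides the length.\<close>

lemma length_bucket:
  assumes "0 < \<omega>"
  shows "length xs div \<omega> \<le> length (bucket xs \<omega> l)"
    and "length (bucket xs \<omega> l) \<le> length xs div \<omega> + 1"
    and "\<omega> dvd length xs \<Longrightarrow> length (bucket xs \<omega> l) = length xs div \<omega>"
proof -
  let ?m = "length xs"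
  let ?r = "(l * ?m mod \<omega> + ?m mod \<omega>) div \<omega>"
  have eq: "length (bucket xs \<omega> l) = ?m div \<omega> + ?r"
    using div_add1_eq[of "l * ?m" ?m \<omega>] by (simp add: bucket_def add.commute)
  have "l * ?m mod \<omega> + ?m mod \<omega> < 2 * \<omega>"
    using assms mod_less_divisor[of \<omega> "l * ?m"] mod_less_divisor[of \<omega> ?m] by linarith
  then have "?r < 2" using assms by (simp add: less_mult_imp_div_less)
  then show "?m div \<omega> \<le> length (bucket xs \<omega> l)" "length (bucket xs \<omega> l) \<le> ?m div \<omega> + 1"
    using eq by simp_all
  show "length (bucket xs \<omega> l) = ?m div \<omega>" if "\<omega> dvd ?m"
    using eq that assms by simp
qed

text \<open>Consecutive buckets share a boundary, so the first \<open>k\<close> of them make up the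
  prefix ending at \<open>k * length xs div \<omega>\<close>; for \<open>k = \<omega>\<close> this
  is the whole list.\<close>

lemma concat_buckets:
  assumes "0 < \<omega>"
  shows "concat (map (bucket xs \<omega>) [0..<\<omega>]) = xs"
proof -
  have "concat (map (bucket xs \<omega>) [0..<k]) = take (k * length xs div \<omega>) xs" if "k \<le> \<omega>" for k
    using that
  proof (induction k)
    case 0
    then show ?case by simp
  next
    case (Suc k)
    let ?a = "k * length xs div \<omega>" and ?b = "(k + 1) * length xs div \<omega>"
    have "?a \<le> ?b" by (intro div_le_mono) simp
    have "Suc k * length xs \<le> \<omega> * length xs"
      using Suc.prems by (intro mult_le_mono1)
    then have "?b \<le> \<omega> * length xs div \<omega>" by (intro div_le_mono) simp
    then have "?b \<le> length xs" using assms by simp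
    then have "take ?a xs @ map ((!) xs) [?a..<?b] = take ?b xs"
      using \<open>?a \<le> ?b\<close>
      by (simp add: list_eq_iff_nth_eq nth_append)
    then show ?case using Suc by (simp add: bucket_def)
  qed
  from this[of \<omega>] show ?thesis using assms by simp
qed

text \<open>The bucket length is bounded crudely by \<open>length xs + 1\<close>. This suffices,
  since only \<omega> buckets are built and \<omega> is bounded. Of the constant 10, six units pay
  for computing the boundaries.\<close>

lemma runs_within_bucket_t:
  assumes "0 < \<omega>"
  shows "runs_within (bucket_t cm xs \<omega> l) (3 * unit_cost cm * length xs + 10 * unit_cost cm)
           (\<lambda>B. B = bucket xs \<omega> l)"
proof -
  let ?is = "[l * length xs div \<omega>..<(l + 1) * length xs div \<omega>]"
  have "length (bucket xs \<omega> l) \<le> length xs + 1"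
    using length_bucket(2)[OF assms, of xs l] div_le_dividend[of "length xs" \<omega>] by linarith
  then have "length ?is * (3 * unit_cost cm) \<le> (length xs + 1) * (3 * unit_cost cm)"
    unfolding bucket_def length_map by (rule mult_le_mono1)
  then have "length ?is * (unit_cost cm + 2 * unit_cost cm) + unit_cost cm
      \<le> 3 * unit_cost cm * length xs + 4 * unit_cost cm"
    by (simp only: algebra_simps)
  then have "runs_within (map_t cm (\<lambda>i. access cm (xs ! i)) ?is)
      (3 * unit_cost cm * length xs + 4 * unit_cost cm) (\<lambda>B. B = bucket xs \<omega> l)"
    unfolding bucket_def
    by (intro runs_within_map_t_eq[where t = "unit_cost cm"]) (auto simp: unit_cost_def)
  then show ?thesis
    by (auto simp: bucket_t_def unit_cost_def elim!: runs_within_weaken)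
qed

text \<open>The sorting cost is kept as a separate summand, to be estimated only at the end. The
  lower bound on the bucket lengths guarantees later that there are enough items to draw
  from.\<close>

lemma runs_within_partition_t:
  assumes "0 < \<omega>" "\<And>p. p \<in> set ps \<Longrightarrow> dim_vec p = d"
  shows "runs_within (partition_t cm ps \<omega>)
           (unit_cost cm * (length ps * (5 * d + 3 * \<omega> + 6) + 12 * \<omega> + 3) + sort_cost cm (length ps))
           (\<lambda>Bs. is_norm_partition ps \<omega> Bs \<and> (\<forall>B \<in> set Bs. length ps div \<omega> \<le> length B))"
proof -
  let ?c = "unit_cost cm" and ?m = "length ps"
  define keyed where "keyed = map (\<lambda>p. (vnorm p, p)) ps"
  define skeyed where "skeyed = sort_key (\<lambda>x. - fst x) keyed"
  define sps where "sps = map snd skeyed"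
  define Bs where "Bs = map (bucket sps \<omega>) [0..<\<omega>]"
  have mset_sps: "mset sps = mset ps"
    by (simp add: sps_def skeyed_def keyed_def mset_map[symmetric] del: mset_map)
       (simp add: multiset.map_comp comp_def)
  have len_sps: "length sps = ?m" using mset_sps by (metis size_mset)
  have "\<forall>x \<in> set skeyed. fst x = vnorm (snd x)" by (auto simp: skeyed_def keyed_def)
  moreover have "sorted_wrt (\<lambda>x y. fst x \<ge> fst y) skeyed"
    using sorted_sort_key[of "\<lambda>x. - fst x" keyed] by (simp add: skeyed_def sorted_map)
  ultimately have sorted_sps: "sorted_wrt (\<lambda>p q. vnorm p \<ge> vnorm q) sps"
    unfolding sps_def sorted_wrt_map by (metis (no_types, lifting) sorted_wrt_mono_rel)
  have lower: "?m div \<omega> \<le> length B" and upper: "length B \<le> ?m div \<omega> + 1"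
    and exact: "\<omega> dvd ?m \<Longrightarrow> length B = ?m div \<omega>" if "B \<in> set Bs" for B
    using that length_bucket[OF assms(1), of sps] by (auto simp: Bs_def len_sps)
  have "length B \<le> length B' + 1" if "B \<in> set Bs" "B' \<in> set Bs" for B B'
    using upper[OF that(1)] lower[OF that(2)] by linarith
  then have partition: "is_norm_partition ps \<omega> Bs"
    using concat_buckets[OF assms(1), of sps] mset_sps sorted_sps exact
    by (simp add: is_norm_partition_def Bs_def)
  have 1: "runs_within (map_t cm (\<lambda>p. norm_t cm p \<then> (\<lambda>r. ret (r, p))) ps)
      (?m * (5 * ?c * d + 2 * ?c + 2 * ?c) + ?c) (\<lambda>ys. ys = keyed)"
    unfolding keyed_def
    by (rule runs_within_map_t_eq)
       (auto intro!: runs_within_bind[OF runs_within_norm_t, where b = 0] simp: assms(2))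
  have 2: "runs_within (map_t cm (\<lambda>x. ret (snd x)) skeyed) (?m * (0 + 2 * ?c) + ?c) (\<lambda>ys. ys = sps)"
    unfolding sps_def
    by (rule runs_within_map_t_eq) (auto simp: skeyed_def keyed_def)
  have 3: "runs_within (map_t cm (bucket_t cm sps \<omega>) [0..<\<omega>])
      (\<omega> * ((3 * ?c * ?m + 10 * ?c) + 2 * ?c) + ?c) (\<lambda>ys. ys = Bs)"
    unfolding Bs_def
    by (rule runs_within_map_t_eq[OF runs_within_bucket_t[OF assms(1), of cm sps, unfolded len_sps]])
       simp
  have 23: "runs_within (map_t cm (\<lambda>x. ret (snd x)) skeyed \<then> (\<lambda>sorted_ps.
       map_t cm (bucket_t cm sorted_ps \<omega>) [0..<\<omega>]))
     ((?m * (0 + 2 * ?c) + ?c) + (\<omega> * ((3 * ?c * ?m + 10 * ?c) + 2 * ?c) + ?c)) (\<lambda>ys. ys = Bs)"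
    by (rule runs_within_bind[OF 2 _ order_refl]) (simp only: 3)
  have "runs_within (sort_desc_t cm keyed \<then> (\<lambda>sorted_keyed.
       map_t cm (\<lambda>x. ret (snd x)) sorted_keyed \<then> (\<lambda>sorted_ps.
       map_t cm (bucket_t cm sorted_ps \<omega>) [0..<\<omega>])))
     (sort_cost cm ?m + ((?m * (0 + 2 * ?c) + ?c) + (\<omega> * ((3 * ?c * ?m + 10 * ?c) + 2 * ?c) + ?c)))
     (\<lambda>ys. ys = Bs)"
    using 23 by (simp add: sort_desc_t_def skeyed_def) (simp add: keyed_def)
  then have "runs_within (partition_t cm ps \<omega>)
      ((?m * (5 * ?c * d + 2 * ?c + 2 * ?c) + ?c) + (sort_cost cm ?m + ((?m * (0 + 2 * ?c) + ?c)
         + (\<omega> * ((3 * ?c * ?m + 10 * ?c) + 2 * ?c) + ?c))))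
     (\<lambda>ys. ys = Bs)"
    unfolding partition_t_def by (intro runs_within_bind[OF 1]) auto
  then show ?thesis
    by (rule runs_within_weaken) (use partition lower in \<open>auto simp: algebra_simps\<close>)
qed

section \<open>Samples, thresholds and the rank table\<close>

text \<open>Only the support of each draw matters, not its probabilities. Each sample costs three
  units: the draw, its storage and the loop round.\<close>

lemma runs_within_samples_t:
  assumes "mode = Without_Replacement \<Longrightarrow> s \<le> length B" "0 < length B" "distinct B"
  shows "runs_within (samples_t cm mode s B) (3 * unit_cost cm * s + unit_cost cm)
           (\<lambda>S. length S = s \<and> set S \<subseteq> set B \<and> (mode = Without_Replacement \<longrightarrow> distinct S))"
proof -
  let ?I = "\<lambda>i S. length S = i \<and> set S \<subseteq> set B \<and> (mode = Without_Replacement \<longrightarrow> distinct S)"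
  let ?A = "\<lambda>S. case mode of With_Replacement \<Rightarrow> set B | Without_Replacement \<Rightarrow> set B - set S"
  have draw: "runs_within (draw_t cm mode B S) (unit_cost cm) (\<lambda>p. p \<in> ?A S)"
    if "?I i S" "i < s" for i S
  proof -
    \<comment> \<open>\<open>pmf_of_set\<close> has the intended support only for a finite nonempty
      set.\<close>
    have "finite (?A S)" by (cases mode) auto
    moreover have "?A S \<noteq> {}"
    proof (cases mode)
      case With_Replacement
      then show ?thesis using assms by auto
    next
      case Without_Replacement
      \<comment> \<open>Pigeonhole: fewer than \<open>s\<close> items have been drawn, while the
        duplicate-free \<open>B\<close> holds at least \<open>s\<close>.\<close>
      have "\<not> set B \<subseteq> set S"
      proof
        assume "set B \<subseteq> set S"
        then have "card (set B) \<le> card (set S)" by (simp add: card_mono)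
        then show False
          using that assms(1)[OF Without_Replacement] card_length[of S] distinct_card[OF assms(3)]
          by linarith
      qed
      then show ?thesis using Without_Replacement by auto
    qed
    ultimately show ?thesis
      by (auto simp: draw_t_def runs_within_def unit_cost_def)
  qed
  have "runs_within (samples_t cm mode s B) (3 * unit_cost cm * s + unit_cost cm)
      (?I (length [0..<s]))"
    unfolding samples_t_def
  proof (rule runs_within_fold_t[where t = "2 * unit_cost cm"])
    fix i S
    assume "i < length [0..<s]" "?I i S"
    then show "runs_within (draw_t cm mode B S \<then> (\<lambda>p. access cm p \<then> (\<lambda>p. ret (p # S))))
        (2 * unit_cost cm) (?I (Suc i))"
      by (intro runs_within_bind[OF draw[of S i], where b = "unit_cost cm"])
         (auto simp: unit_cost_def split: sampling.splits)
  qed (auto simp: algebra_simps)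
  then show ?thesis by simp
qed

text \<open>Six arithmetic operations and two units of loop overhead per threshold give the factor
  8.\<close>

lemma runs_within_thresholds_t:
  "runs_within (thresholds_t cm fmin fmax ftime \<tau> u)
     (ftime u + 8 * unit_cost cm * \<tau> + unit_cost cm)
     (\<lambda>ts. ts = map (threshold (fmin u) (fmax u) \<tau>) [1..<\<tau> + 1])"
proof -
  have "runs_within (map_t cm (\<lambda>j.
       arith cm (real j - 1) \<then> (\<lambda>j'.
       arith cm (fmax u - fmin u) \<then> (\<lambda>w.
       arith cm (real \<tau> - 1) \<then> (\<lambda>k.
       arith cm (w / k) \<then> (\<lambda>q.
       arith cm (j' * q) \<then> (\<lambda>x.
       arith cm (fmin u + x))))))) [1..<\<tau> + 1]) (8 * unit_cost cm * \<tau> + unit_cost cm)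
     (\<lambda>ts. ts = map (threshold (fmin u) (fmax u) \<tau>) [1..<\<tau> + 1])"
    by (rule runs_within_map_t_eq[where t = "6 * unit_cost cm"])
       (auto simp: threshold_def unit_cost_def)
  then show ?thesis by (simp add: thresholds_t_def)
qed

text \<open>The step \<open>(hi - lo) / (\<tau> - 1)\<close> between neighbours is
  nonnegative.\<close>

lemma sorted_thresholds:
  assumes "lo \<le> hi" "2 \<le> \<tau>"
  shows "sorted (map (threshold lo hi \<tau>) [1..<\<tau> + 1])"
proof -
  have "threshold lo hi \<tau> i \<le> threshold lo hi \<tau> j" if "i \<le> j" for i j
    unfolding threshold_def using assms that by (intro add_left_mono mult_right_mono) auto
  then show ?thesis
    unfolding sorted_map by (intro sorted_wrt_mono_rel[OF _ sorted_upt]) auto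
qed

text \<open>The specification tests every threshold, whereas the scan may stop early; sortedness
  makes the two agree. A successful round uses at most three operations of each kind, hence three
  units.\<close>

lemma runs_within_scan_t:
  assumes "sorted ts" "length ts = length cs"
  shows "runs_within (scan_t cm x ts cs) (3 * unit_cost cm * length ts + unit_cost cm)
           (\<lambda>cs'. cs' = map2 (\<lambda>t c. if x > t then c + 1 else c) ts cs)"
  using assms(2,1)
proof (induction ts cs rule: list_induct2)
  case Nil
  then show ?case by (simp add: unit_cost_def)
next
  case (Cons t ts c cs)
  let ?g = "\<lambda>t c. if x > t then c + 1 else c"
  show ?case
  proof (cases "x > t")
    case True
    have "runs_within (scan_t cm x ts cs \<then> (\<lambda>cs'. ret ((c + 1) # cs')))
        (3 * unit_cost cm * length ts + unit_cost cm) (\<lambda>cs'. cs' = map2 ?g (t # ts) (c # cs))"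
      by (rule runs_within_bind[OF Cons.IH, where b = 0]) (use Cons.prems True in auto)
    then show ?thesis
      using True by (auto simp: iter_def unit_cost_def elim!: runs_within_weaken)
  next
    case False
    \<comment> \<open>All later thresholds are at least \<open>t\<close>, hence at least
      \<open>x\<close>, so none of the skipped counters would have changed.\<close>
    have "map2 ?g ts cs = map2 (\<lambda>t c. c) ts cs"
      using Cons.prems False by (intro map_cong) (auto dest!: set_zip_leftD)
    also have "\<dots> = cs"
      using Cons.hyps by (simp add: map_snd_zip[unfolded snd_def])
    finally show ?thesis
      using False by (simp add: iter_def unit_cost_def)
  qed
qed

text \<open>The loop runs over samples while the result is stated per threshold; the invariant links
  them by counting among the first \<open>i\<close> samples. Each sample costs one inner product and
  one scan.\<close>

lemma runs_within_counts_t: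
  assumes "sorted ts" "\<And>p. p \<in> set S \<Longrightarrow> dim_vec p = d"
  shows "runs_within (counts_t cm u ts S)
           (unit_cost cm * (2 * length ts + 2 + length S * (5 * d + 3 * length ts + 3)))
           (\<lambda>cs. cs = map (\<lambda>t. length (filter (\<lambda>p. scalar_prod u p > t) S)) ts)"
proof -
  let ?I = "\<lambda>i cs. cs = map (\<lambda>t. length (filter (\<lambda>p. scalar_prod u p > t) (take i S))) ts"
  have zeros: "runs_within (map_t cm (\<lambda>_. ret (0 :: nat)) ts)
      (length ts * (0 + 2 * unit_cost cm) + unit_cost cm) (\<lambda>zs. zs = map (\<lambda>_. 0) ts)"
    by (rule runs_within_map_t_eq) auto
  have "runs_within (fold_t cm (\<lambda>cs p. inner_t cm u p \<then> (\<lambda>x. scan_t cm x ts cs)) (map (\<lambda>_. 0) ts) S)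
      (length S * (unit_cost cm * (5 * d + 3 * length ts + 2) + unit_cost cm) + unit_cost cm)
      (?I (length S))"
  proof (rule runs_within_fold_t)
    fix i cs
    assume i: "i < length S" and cs: "?I i cs"
    have "map2 (\<lambda>t c. if scalar_prod u (S ! i) > t then c + 1 else c) ts cs
        = map (\<lambda>t. length (filter (\<lambda>p. scalar_prod u p > t) (take (Suc i) S))) ts"
      using i by (simp add: cs take_Suc_conv_app_nth list_eq_iff_nth_eq)
    moreover have "dim_vec (S ! i) = d" using assms(2) i by simp
    ultimately show "runs_within (inner_t cm u (S ! i) \<then> (\<lambda>x. scan_t cm x ts cs))
        (unit_cost cm * (5 * d + 3 * length ts + 2)) (?I (Suc i))"
      using runs_within_scan_t[OF assms(1), of cs cm "scalar_prod u (S ! i)"] cs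
      by (intro runs_within_bind[OF runs_within_inner_t,
            where b = "3 * unit_cost cm * length ts + unit_cost cm"])
         (auto simp: algebra_simps)
  qed auto
  then have "runs_within (counts_t cm u ts S)
      ((length ts * (0 + 2 * unit_cost cm) + unit_cost cm) +
       (length S * (unit_cost cm * (5 * d + 3 * length ts + 2) + unit_cost cm) + unit_cost cm))
      (?I (length S))"
    unfolding counts_t_def by (intro runs_within_bind[OF zeros]) auto
  then show ?thesis by (rule runs_within_weaken) (auto simp: algebra_simps)
qed

text \<open>Per bucket, the counting contributes \<open>2 * length ts\<close> units apart from the
  samples, and the update of the row \<open>7 * length ts\<close>: five operations and two units of
  overhead per entry.\<close>

lemma runs_within_row_t:
  assumes "sorted ts" "length Ss = length Bs"
    and "\<And>S. S \<in> set Ss \<Longrightarrow> length S = s"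
    and "\<And>S p. S \<in> set Ss \<Longrightarrow> p \<in> set S \<Longrightarrow> dim_vec p = d"
  shows "runs_within (row_t cm s Bs Ss u ts)
           (unit_cost cm * (2 * length ts + 2
              + length Bs * (9 * length ts + 6 + s * (5 * d + 3 * length ts + 3))))
           (\<lambda>row. row = map (rank_entry s Bs Ss u) ts)"
proof -
  let ?c = "unit_cost cm"
  let ?e = "\<lambda>t l. real (length (Bs ! l)) * real (length (filter (\<lambda>p. scalar_prod u p > t) (Ss ! l))) / real s"
  \<comment> \<open>This is \<open>rank_entry\<close> with its sum cut off after the first
    \<open>i\<close> buckets.\<close>
  let ?I = "\<lambda>i row. row = map (\<lambda>t. 1 + (\<Sum>l<i. ?e t l)) ts"
  let ?t = "?c * (9 * length ts + 5 + s * (5 * d + 3 * length ts + 3))"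
  have ones: "runs_within (map_t cm (\<lambda>_. ret (1 :: real)) ts)
      (length ts * (0 + 2 * ?c) + ?c) (\<lambda>zs. zs = map (\<lambda>_. 1) ts)"
    by (rule runs_within_map_t_eq) auto
  have "runs_within (fold_t cm (\<lambda>row l.
       access cm (length (Bs ! l)) \<then> (\<lambda>size_l.
       access cm (Ss ! l) \<then> (\<lambda>S.
       counts_t cm u ts S \<then> (\<lambda>cs.
       map_t cm (\<lambda>j.
         access cm (row ! j) \<then> (\<lambda>r.
         access cm (cs ! j) \<then> (\<lambda>c.
         arith cm (real size_l * real c) \<then> (\<lambda>y.
         arith cm (y / real s) \<then> (\<lambda>z.
         arith cm (r + z)))))) [0..<length ts]))))
     (map (\<lambda>_. 1) ts) [0..<length Bs]) (length Bs * (?t + ?c) + ?c) (?I (length [0..<length Bs]))"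
  proof (rule runs_within_fold_t)
    fix i row
    assume "i < length [0..<length Bs]" and row: "?I i row"
    then have i: "i < length Bs" "[0..<length Bs] ! i = i" "Ss ! i \<in> set Ss"
      using assms(2) by auto
    let ?cs = "map (\<lambda>t. length (filter (\<lambda>p. scalar_prod u p > t) (Ss ! i))) ts"
    have add: "runs_within (map_t cm (\<lambda>j.
         access cm (row ! j) \<then> (\<lambda>r.
         access cm (?cs ! j) \<then> (\<lambda>c.
         arith cm (real (length (Bs ! i)) * real c) \<then> (\<lambda>y.
         arith cm (y / real s) \<then> (\<lambda>z.
         arith cm (r + z)))))) [0..<length ts]) (7 * ?c * length ts + ?c) (?I (Suc i))"
    proof (rule runs_within_weaken[OF runs_within_map_t_eq[where t = "5 * ?c"
            and g = "\<lambda>j. row ! j + ?e (ts ! j) i", OF _ order_refl]])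
      have "map (\<lambda>j. row ! j + ?e (ts ! j) i) [0..<length ts] = map (\<lambda>t. 1 + (\<Sum>l<Suc i. ?e t l)) ts"
        by (intro nth_equalityI) (simp_all add: row)
      then show "row' = map (\<lambda>j. row ! j + ?e (ts ! j) i) [0..<length ts] \<Longrightarrow> ?I (Suc i) row'" for row'
        by simp
    next
      fix j assume "j \<in> set [0..<length ts]"
      then show "runs_within (access cm (row ! j) \<then> (\<lambda>r.
         access cm (?cs ! j) \<then> (\<lambda>c.
         arith cm (real (length (Bs ! i)) * real c) \<then> (\<lambda>y.
         arith cm (y / real s) \<then> (\<lambda>z.
         arith cm (r + z)))))) (5 * ?c) (\<lambda>r. r = row ! j + ?e (ts ! j) i)"
        by (simp add: unit_cost_def)
    qed (simp add: algebra_simps)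
    have "runs_within (counts_t cm u ts (Ss ! i))
        (?c * (2 * length ts + 2 + s * (5 * d + 3 * length ts + 3))) (\<lambda>cs. cs = ?cs)"
      using runs_within_counts_t[of ts "Ss ! i" d cm u] assms(1) assms(3,4)[OF i(3)] by simp
    then have "runs_within (counts_t cm u ts (Ss ! i) \<then> (\<lambda>cs.
       map_t cm (\<lambda>j.
         access cm (row ! j) \<then> (\<lambda>r.
         access cm (cs ! j) \<then> (\<lambda>c.
         arith cm (real (length (Bs ! i)) * real c) \<then> (\<lambda>y.
         arith cm (y / real s) \<then> (\<lambda>z.
         arith cm (r + z)))))) [0..<length ts]))
        (?c * (2 * length ts + 2 + s * (5 * d + 3 * length ts + 3)) + (7 * ?c * length ts + ?c))
        (?I (Suc i))"
      by (rule runs_within_bind[OF _ _ order_refl]) (simp only: add)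
    note body = this
    show "runs_within (access cm (length (Bs ! ([0..<length Bs] ! i))) \<then> (\<lambda>size_l.
       access cm (Ss ! ([0..<length Bs] ! i)) \<then> (\<lambda>S.
       counts_t cm u ts S \<then> (\<lambda>cs.
       map_t cm (\<lambda>j.
         access cm (row ! j) \<then> (\<lambda>r.
         access cm (cs ! j) \<then> (\<lambda>c.
         arith cm (real size_l * real c) \<then> (\<lambda>y.
         arith cm (y / real s) \<then> (\<lambda>z.
         arith cm (r + z)))))) [0..<length ts])))) ?t (?I (Suc i))"
      unfolding i(2) runs_within_charge_bind
      by (intro conjI runs_within_weaken[OF body]) (auto simp: unit_cost_def algebra_simps)
  qed auto
  then have "runs_within (row_t cm s Bs Ss u ts)
      ((length ts * (0 + 2 * ?c) + ?c) + (length Bs * (?t + ?c) + ?c)) (?I (length [0..<length Bs]))"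
    unfolding row_t_def by (intro runs_within_bind[OF ones]) auto
  then show ?thesis
    by (rule runs_within_weaken) (auto simp: algebra_simps rank_entry_def)
qed

text \<open>The bounds of the four stages are added up exactly, with per-item and per-user costs
  kept apart. The constant 6 consists of 3 from partitioning and one final loop test for each of the
  other three loops.\<close>

lemma runs_within_preprocess_t:
  assumes "set us \<subseteq> carrier_vec d" "distinct ps" "set ps \<subseteq> carrier_vec d"
    and "2 \<le> \<tau>" "0 < \<omega>" "\<omega> \<le> length ps"
    and s: "mode = Without_Replacement \<Longrightarrow> s \<le> length ps div \<omega>"
    and f: "\<And>u. u \<in> set us \<Longrightarrow> fmin u \<le> fmax u \<and> ftime u \<le> K"
  shows "runs_within (preprocess_t cm mode fmin fmax ftime us ps \<tau> \<omega> s)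
           (unit_cost cm * (length ps * (5 * d + 3 * \<omega> + 6) + 12 * \<omega> + \<omega> * (3 * s + 3) + 6)
              + sort_cost cm (length ps)
              + length us * (K + unit_cost cm
                  * (10 * \<tau> + 9 + \<omega> * (9 * \<tau> + 6 + s * (5 * d + 3 * \<tau> + 3)))))
           (\<lambda>(Ts, table). is_rank_table_output mode fmin fmax us ps \<tau> \<omega> s Ts table)"
proof -
  let ?c = "unit_cost cm"
  define thr where "thr = (\<lambda>u. map (threshold (fmin u) (fmax u) \<tau>) [1..<\<tau> + 1])"
  let ?part = "?c * (length ps * (5 * d + 3 * \<omega> + 6) + 12 * \<omega> + 3) + sort_cost cm (length ps)"
  let ?samp = "\<omega> * (3 * ?c * s + ?c + 2 * ?c) + ?c"
  let ?thrs = "length us * ((K + 8 * ?c * \<tau> + ?c) + 2 * ?c) + ?c"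
  let ?row = "?c * (2 * \<tau> + 2 + \<omega> * (9 * \<tau> + 6 + s * (5 * d + 3 * \<tau> + 3)))"
  let ?table = "length us * ((?row + 2 * ?c) + 2 * ?c) + ?c"
  let ?S = "\<lambda>B S. length S = s \<and> set S \<subseteq> set B \<and> (mode = Without_Replacement \<longrightarrow> distinct S)"
  define Q where "Q = (\<lambda>(Ts, table). is_rank_table_output mode fmin fmax us ps \<tau> \<omega> s Ts table)"
  have partition: "runs_within (partition_t cm ps \<omega>) ?part
      (\<lambda>Bs. is_norm_partition ps \<omega> Bs \<and> (\<forall>B \<in> set Bs. length ps div \<omega> \<le> length B))"
    using assms by (intro runs_within_partition_t) auto
  have len_thr: "length (thr u) = \<tau>" for u
    by (simp only: thr_def length_map length_upt diff_add_inverse2)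
  have thresholds: "runs_within (map_t cm (thresholds_t cm fmin fmax ftime \<tau>) us) ?thrs
      (\<lambda>Ts. Ts = map thr us)"
    unfolding thr_def
    by (rule runs_within_map_t_eq[OF runs_within_weaken[OF runs_within_thresholds_t,
            where t' = "K + 8 * ?c * \<tau> + ?c"]])
       (use f in auto)
  have "runs_within (map_t cm (samples_t cm mode s) Bs \<then> (\<lambda>Ss.
     map_t cm (thresholds_t cm fmin fmax ftime \<tau>) us \<then> (\<lambda>Ts.
     map_t cm (\<lambda>i.
       access cm (us ! i) \<then> (\<lambda>u.
       access cm (Ts ! i) \<then> (\<lambda>ts.
       row_t cm s Bs Ss u ts))) [0..<length us] \<then> (\<lambda>table.
     ret (Ts, table))))) (?samp + (?thrs + (?table + 0))) Q"
    if Bs: "is_norm_partition ps \<omega> Bs \<and> (\<forall>B \<in> set Bs. length ps div \<omega> \<le> length B)" for Bs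
  proof -
    have "length Bs = \<omega>" and "mset (concat Bs) = mset ps"
      using Bs by (auto simp: is_norm_partition_def)
    \<comment> \<open>Equality of multisets carries distinctness over to the buckets and shows that
      every sampled item comes from \<open>ps\<close>, hence has dimension \<open>d\<close>.\<close>
    then have concat: "distinct (concat Bs)" "set (concat Bs) = set ps"
      using assms(2) by (metis mset_eq_imp_distinct_iff, metis mset_eq_setD)
    \<comment> \<open>By \<open>\<omega> \<le> length ps\<close> every bucket has an item to
      draw.\<close>
    have "0 < length ps div \<omega>"
      using assms by (simp add: div_greater_zero_iff)
    have "runs_within (samples_t cm mode s B) (3 * ?c * s + ?c) (?S B)" if "B \<in> set Bs" for B
    proof (rule runs_within_samples_t)
      show "distinct B" using concat(1) that by (simp add: distinct_concat_iff)
      show "0 < length B" using Bs that \<open>0 < length ps div \<omega>\<close> by fastforce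
      show "s \<le> length B" if "mode = Without_Replacement"
        using s[OF that] Bs \<open>B \<in> set Bs\<close> by fastforce
    qed
    then have samples: "runs_within (map_t cm (samples_t cm mode s) Bs) ?samp (list_all2 ?S Bs)"
      using runs_within_map_t[of Bs "samples_t cm mode s" "3 * ?c * s + ?c" ?S cm] \<open>length Bs = \<omega>\<close>
      by simp
    \<comment> \<open>Once the samples are fixed the table is determined, so it is computed for each
      possible outcome \<open>Ss\<close>.\<close>
    have table: "runs_within (map_t cm (\<lambda>i.
         access cm (us ! i) \<then> (\<lambda>u.
         access cm (map thr us ! i) \<then> (\<lambda>ts.
         row_t cm s Bs Ss u ts))) [0..<length us]) ?table
        (\<lambda>table. table = map (\<lambda>i. map (rank_entry s Bs Ss (us ! i)) (thr (us ! i))) [0..<length us])"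
      if Ss: "list_all2 ?S Bs Ss" for Ss
    proof (rule runs_within_map_t_eq)
      fix i assume i: "i \<in> set [0..<length us]"
      have "runs_within (row_t cm s Bs Ss (us ! i) (thr (us ! i))) ?row
          (\<lambda>row. row = map (rank_entry s Bs Ss (us ! i)) (thr (us ! i)))"
      proof -
        have sample: "length S = s \<and> set S \<subseteq> set ps" if S: "S \<in> set Ss" for S
        proof -
          obtain l where "l < length Ss" "S = Ss ! l"
            using S by (auto simp: in_set_conv_nth)
          then have "?S (Bs ! l) S" "Bs ! l \<in> set Bs"
            using list_all2_nthD2[OF Ss] list_all2_lengthD[OF Ss] by auto
          then show ?thesis using concat(2) by auto
        qed
        have len_S: "length S = s" if "S \<in> set Ss" for S
          using sample[OF that] by simp
        have dim: "dim_vec p = d" if "S \<in> set Ss" "p \<in> set S" for S p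
          using sample[OF that(1)] that(2) assms(3) by auto
        have sorted: "sorted (thr (us ! i))"
          unfolding thr_def using f i assms(4) by (intro sorted_thresholds) auto
        show ?thesis
        proof (rule runs_within_weaken[OF runs_within_row_t[of "thr (us ! i)" Ss Bs s d]])
          show "length Ss = length Bs" using list_all2_lengthD[OF Ss] by simp
        qed (fact sorted len_S dim | simp only: len_thr \<open>length Bs = \<omega>\<close> order_refl)+
      qed
      note row = this
      have "map thr us ! i = thr (us ! i)" using i by simp
      show "runs_within (access cm (us ! i) \<then> (\<lambda>u.
         access cm (map thr us ! i) \<then> (\<lambda>ts.
         row_t cm s Bs Ss u ts))) (?row + 2 * ?c)
         (\<lambda>row. row = map (rank_entry s Bs Ss (us ! i)) (thr (us ! i)))"
        unfolding runs_within_charge_bind \<open>map thr us ! i = _\<close>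
        by (intro conjI runs_within_weaken[OF row]) (auto simp: unit_cost_def)
    qed simp
    \<comment> \<open>The buckets and samples of the run itself witness the existential quantifiers
      of the output specification.\<close>
    have out: "Q (map thr us, map (\<lambda>i. map (rank_entry s Bs Ss (us ! i)) (thr (us ! i))) [0..<length us])"
      if Ss: "list_all2 ?S Bs Ss" for Ss
    proof -
      have "are_samples mode s Bs Ss"
        using Ss by (auto simp: are_samples_def list_all2_conv_all_nth)
      \<comment> \<open>Position \<open>j - 1\<close> of \<open>[1..<\<tau> + 1]\<close> holds
        \<open>j\<close>, which reconciles the two index origins.\<close>
      moreover have "thr u ! (j - 1) = threshold (fmin u) (fmax u) \<tau> j" if "j \<in> {1..\<tau>}" for u j
        using that unfolding thr_def by (subst nth_map) (auto simp del: upt_Suc)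
      ultimately show ?thesis
        using Bs unfolding Q_def is_rank_table_output_def prod.case
        by (intro conjI exI[of _ Bs] exI[of _ Ss] allI ballI impI) (auto simp: len_thr)
    qed
    show ?thesis
    proof (rule runs_within_bind[OF samples _ order_refl])
      fix Ss assume Ss: "list_all2 ?S Bs Ss"
      show "runs_within (map_t cm (thresholds_t cm fmin fmax ftime \<tau>) us \<then> (\<lambda>Ts.
         map_t cm (\<lambda>i.
           access cm (us ! i) \<then> (\<lambda>u.
           access cm (Ts ! i) \<then> (\<lambda>ts.
           row_t cm s Bs Ss u ts))) [0..<length us] \<then> (\<lambda>table.
         ret (Ts, table)))) (?thrs + (?table + 0)) Q"
      proof (rule runs_within_bind[OF thresholds _ order_refl], hypsubst)
        show "runs_within (map_t cm (\<lambda>i.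
           access cm (us ! i) \<then> (\<lambda>u.
           access cm (map thr us ! i) \<then> (\<lambda>ts.
           row_t cm s Bs Ss u ts))) [0..<length us] \<then> (\<lambda>table.
         ret (map thr us, table))) (?table + 0) Q"
          by (rule runs_within_bind[OF table[OF Ss] _ order_refl]) (simp only: runs_within_ret out[OF Ss])
      qed
    qed
  qed
  then have "runs_within (preprocess_t cm mode fmin fmax ftime us ps \<tau> \<omega> s)
      (?part + (?samp + (?thrs + (?table + 0)))) Q"
    unfolding preprocess_t_def by (rule runs_within_bind[OF partition _ order_refl])
  then show ?thesis
    by (rule runs_within_weaken) (simp_all add: Q_def algebra_simps)
qed

section \<open>Asymptotics\<close>

text \<open>Makes the asymptotic bound uniform from \<open>m = 1\<close> on. Since
  \<open>m * log 2 m\<close> vanishes at 1, the summand \<open>real m\<close> is added: it keeps the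
  right-hand side at least 1, so finitely many exceptional values can be absorbed into the
  constant.\<close>

lemma bigo_log_linear_bound:
  fixes g :: "nat \<Rightarrow> real"
  assumes "g \<in> O(\<lambda>m. real m * log 2 (real m))"
  obtains C where "0 < C" "\<And>m. 1 \<le> m \<Longrightarrow> g m \<le> C * (real m + real m * log 2 (real m))"
proof -
  obtain c where "0 < c" and c: "\<forall>\<^sub>F m in sequentially. norm (g m) \<le> c * norm (real m * log 2 (real m))"
    using assms by (elim landau_o.bigE)
  then obtain N where N: "\<And>m. N \<le> m \<Longrightarrow> norm (g m) \<le> c * norm (real m * log 2 (real m))"
    by (auto simp: eventually_sequentially)
  \<comment> \<open>Dominates each of the finitely many values below the threshold
    \<open>N\<close>.\<close>
  define M where "M = (\<Sum>m<N. \<bar>g m\<bar>)"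
  have "0 \<le> M" by (simp add: M_def sum_nonneg)
  have "g m \<le> (c + M) * (real m + real m * log 2 (real m))" if "1 \<le> m" for m
  proof -
    have L: "0 \<le> real m * log 2 (real m)" using that by simp
    then have "1 \<le> real m + real m * log 2 (real m)" using that by linarith
    show ?thesis
    proof (cases "N \<le> m")
      case True
      then have "g m \<le> c * (real m * log 2 (real m))" using N[OF True] L by simp
      also have "\<dots> \<le> (c + M) * (real m + real m * log 2 (real m))"
        using \<open>0 < c\<close> \<open>0 \<le> M\<close> L by (intro mult_mono) auto
      finally show ?thesis .
    next
      case False
      then have "\<bar>g m\<bar> \<le> M" unfolding M_def by (intro member_le_sum) auto
      then have "g m \<le> M * 1" by simp
      also have "\<dots> \<le> (c + M) * (real m + real m * log 2 (real m))"
        using \<open>0 < c\<close> \<open>0 \<le> M\<close> \<open>1 \<le> real m + _\<close> by (intro mult_mono) auto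
      finally show ?thesis .
    qed
  qed
  then show thesis using that[of "c + M"] \<open>0 < c\<close> \<open>0 \<le> M\<close> by simp
qed

text \<open>Every parameter is replaced by its bound \<open>K\<close>, and every term lacking a
  factor \<open>d\<close> or \<open>m * d\<close> is multiplied by it, as both are at least 1. For
  the items, 17 arises as 5 + 6 + 6 and \<open>18 * K\<close> as
  \<open>3 * K + 12 * K + 3 * K\<close>.\<close>

lemma preprocess_cost_le:
  fixes c d n m \<tau> \<omega> s K :: nat
  assumes "1 \<le> d" "1 \<le> m" "\<tau> \<le> K" "\<omega> \<le> K" "s \<le> K"
  shows "c * (m * (5 * d + 3 * \<omega> + 6) + 12 * \<omega> + \<omega> * (3 * s + 3) + 6)
            + n * (K + c * (10 * \<tau> + 9 + \<omega> * (9 * \<tau> + 6 + s * (5 * d + 3 * \<tau> + 3))))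
         \<le> (c * (17 + 18 * K + 3 * K * K) + (K + c * (9 + 16 * K + K * (9 * K + K * (8 + 3 * K)))))
            * ((n + m) * d)"
proof -
  have K: "K \<le> K * d" "1 \<le> m * d" using assms by auto
  have "5 * d + 3 * \<omega> + 6 \<le> 11 * d + 3 * (K * d)" using assms K by linarith
  also have "\<dots> = (11 + 3 * K) * d" by (simp add: algebra_simps)
  finally have "5 * d + 3 * \<omega> + 6 \<le> (11 + 3 * K) * d" .
  then have "m * (5 * d + 3 * \<omega> + 6) \<le> m * ((11 + 3 * K) * d)" by (rule mult_le_mono2)
  also have "\<dots> = (11 + 3 * K) * (m * d)" by simp
  finally have "m * (5 * d + 3 * \<omega> + 6) \<le> (11 + 3 * K) * (m * d)" .
  moreover have "12 * \<omega> + \<omega> * (3 * s + 3) + 6 \<le> 12 * K + K * (3 * K + 3) + 6"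
    using assms by (intro add_mono mult_le_mono) auto
  moreover have "12 * K + K * (3 * K + 3) + 6 \<le> (12 * K + K * (3 * K + 3) + 6) * (m * d)"
    using K by simp
  ultimately have "m * (5 * d + 3 * \<omega> + 6) + 12 * \<omega> + \<omega> * (3 * s + 3) + 6
      \<le> (17 + 18 * K + 3 * K * K) * (m * d)"
    by (simp add: algebra_simps)
  then have items: "c * (m * (5 * d + 3 * \<omega> + 6) + 12 * \<omega> + \<omega> * (3 * s + 3) + 6)
      \<le> c * (17 + 18 * K + 3 * K * K) * (m * d)"
    by (metis mult.assoc mult_le_mono2)
  have "5 * d + 3 * \<tau> + 3 \<le> (8 + 3 * K) * d"
  proof -
    have "5 * d + 3 * \<tau> + 3 \<le> 8 * d + 3 * (K * d)" using assms K by linarith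
    then show ?thesis by (simp add: algebra_simps)
  qed
  then have "s * (5 * d + 3 * \<tau> + 3) \<le> K * ((8 + 3 * K) * d)"
    using assms by (intro mult_le_mono) auto
  moreover have "9 * \<tau> + 6 \<le> (9 * K + 6) * d"
  proof -
    have "9 * \<tau> + 6 \<le> 9 * (K * d) + 6 * d" using assms K by linarith
    then show ?thesis by (simp add: algebra_simps)
  qed
  ultimately have "9 * \<tau> + 6 + s * (5 * d + 3 * \<tau> + 3) \<le> (9 * K + 6 + K * (8 + 3 * K)) * d"
    by (simp add: algebra_simps)
  then have "\<omega> * (9 * \<tau> + 6 + s * (5 * d + 3 * \<tau> + 3)) \<le> K * ((9 * K + 6 + K * (8 + 3 * K)) * d)"
    using assms by (intro mult_le_mono) auto
  moreover have "10 * \<tau> + 9 \<le> (10 * K + 9) * d"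
  proof -
    have "10 * \<tau> + 9 \<le> 10 * (K * d) + 9 * d" using assms K by linarith
    then show ?thesis by (simp add: algebra_simps)
  qed
  \<comment> \<open>The coefficient \<open>16 * K\<close> joins \<open>10 * K\<close> with the
    \<open>6 * K\<close> coming from the factor \<omega>.\<close>
  ultimately have "10 * \<tau> + 9 + \<omega> * (9 * \<tau> + 6 + s * (5 * d + 3 * \<tau> + 3))
      \<le> (9 + 16 * K + K * (9 * K + K * (8 + 3 * K))) * d"
    by (simp add: algebra_simps)
  then have "c * (10 * \<tau> + 9 + \<omega> * (9 * \<tau> + 6 + s * (5 * d + 3 * \<tau> + 3)))
      \<le> c * ((9 + 16 * K + K * (9 * K + K * (8 + 3 * K))) * d)"
    by (rule mult_le_mono2)
  then have "K + c * (10 * \<tau> + 9 + \<omega> * (9 * \<tau> + 6 + s * (5 * d + 3 * \<tau> + 3)))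
      \<le> (K + c * (9 + 16 * K + K * (9 * K + K * (8 + 3 * K)))) * d" (is "?l \<le> ?r * d")
    using K by (simp only: add_mult_distrib mult.assoc)
  then have "n * ?l \<le> n * (?r * d)" by (rule mult_le_mono2)
  then have users: "n * ?l \<le> ?r * (n * d)" by (simp only: mult.left_commute)
  have "c * (17 + 18 * K + 3 * K * K) * (m * d) \<le> c * (17 + 18 * K + 3 * K * K) * ((n + m) * d)"
    and "?r * (n * d) \<le> ?r * ((n + m) * d)"
    by (intro mult_le_mono2 mult_le_mono1; simp)+
  then show ?thesis
    using items users by (simp only: add_mult_distrib[of "c * (17 + 18 * K + 3 * K * K)" ?r])
qed

text \<open>Being O(1) is expressed by fixing \<open>K\<close> beforehand; the constant found,
  \<open>real A + C\<close>, depends only on \<open>K\<close> and the cost model.\<close>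

theorem mainTheorem2:
  fixes cm :: cost_model and K :: nat
  assumes "(\<lambda>m. real (sort_cost cm m)) \<in> O(\<lambda>m. real m * log 2 (real m))"
  shows "\<exists>C > (0 :: real). \<forall>(d :: nat) (n :: nat) (m :: nat) (us :: rvec list) (ps :: rvec list)
           (\<tau> :: nat) (\<omega> :: nat) (s :: nat) (mode :: sampling)
           (fmin :: rvec \<Rightarrow> real) (fmax :: rvec \<Rightarrow> real) (ftime :: rvec \<Rightarrow> nat).
         1 \<le> d \<longrightarrow>
         distinct us \<and> length us = n \<and> set us \<subseteq> carrier_vec d \<longrightarrow>
         distinct ps \<and> length ps = m \<and> set ps \<subseteq> carrier_vec d \<longrightarrow>
         2 \<le> \<tau> \<and> \<tau> \<le> K \<longrightarrow>
         1 \<le> \<omega> \<and> \<omega> \<le> K \<and> \<omega> \<le> m \<longrightarrow>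
         1 \<le> s \<and> s \<le> K \<and> (mode = Without_Replacement \<longrightarrow> s \<le> m div \<omega>) \<longrightarrow>
         (\<forall>u \<in> set us. fmin u \<le> fmax u \<and> ftime u \<le> K) \<longrightarrow>
         (\<forall>((Ts, table), time) \<in> set_pmf (preprocess_t cm mode fmin fmax ftime us ps \<tau> \<omega> s).
            is_rank_table_output mode fmin fmax us ps \<tau> \<omega> s Ts table \<and>
            real time \<le> C * ((real n + real m) * real d + real m * log 2 (real m)))"
proof -
  obtain C where C: "0 < C"
    "\<And>m. 1 \<le> m \<Longrightarrow> real (sort_cost cm m) \<le> C * (real m + real m * log 2 (real m))"
    using bigo_log_linear_bound[OF assms] by blast
  \<comment> \<open>The coefficient from \<open>preprocess_cost_le\<close>, taken at the unit
    cost.\<close>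
  define A where "A = (let c = unit_cost cm in
    c * (17 + 18 * K + 3 * K * K) + (K + c * (9 + 16 * K + K * (9 * K + K * (8 + 3 * K)))))"
  have main: "is_rank_table_output mode fmin fmax us ps \<tau> \<omega> s Ts table \<and>
      real time \<le> (real A + C) * ((real n + real m) * real d + real m * log 2 (real m))"
    if "1 \<le> d" and us: "length us = n" "set us \<subseteq> carrier_vec d"
      and ps: "distinct ps" "length ps = m" "set ps \<subseteq> carrier_vec d"
      and params: "2 \<le> \<tau>" "\<tau> \<le> K" "1 \<le> \<omega>" "\<omega> \<le> K" "\<omega> \<le> m" "s \<le> K"
        "mode = Without_Replacement \<longrightarrow> s \<le> m div \<omega>"
      and f: "\<forall>u \<in> set us. fmin u \<le> fmax u \<and> ftime u \<le> K"
      and run: "((Ts, table), time) \<in> set_pmf (preprocess_t cm mode fmin fmax ftime us ps \<tau> \<omega> s)"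
    for d n m us ps \<tau> \<omega> s mode fmin fmax ftime Ts table time
  proof
    let ?c = "unit_cost cm"
    let ?T = "?c * (m * (5 * d + 3 * \<omega> + 6) + 12 * \<omega> + \<omega> * (3 * s + 3) + 6)
            + n * (K + ?c * (10 * \<tau> + 9 + \<omega> * (9 * \<tau> + 6 + s * (5 * d + 3 * \<tau> + 3))))"
    let ?L = "real m * log 2 (real m)"
    have "runs_within (preprocess_t cm mode fmin fmax ftime us ps \<tau> \<omega> s) (?T + sort_cost cm m)
        (\<lambda>(Ts, table). is_rank_table_output mode fmin fmax us ps \<tau> \<omega> s Ts table)"
      by (rule runs_within_weaken[OF runs_within_preprocess_t[where d = d and K = K]])
         (use us ps params f in auto)
    with run have time: "time \<le> ?T + sort_cost cm m"
      and out: "is_rank_table_output mode fmin fmax us ps \<tau> \<omega> s Ts table"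
      unfolding runs_within_def by fastforce+
    show "is_rank_table_output mode fmin fmax us ps \<tau> \<omega> s Ts table" by (rule out)
    have "1 \<le> m" using params by simp
    then have "0 \<le> ?L" by simp
    \<comment> \<open>Since \<open>d\<close> is at least 1, the linear summand of the sorting bound
      is absorbed by \<open>(n + m) * d\<close>.\<close>
    have "real m \<le> (real n + real m) * real d"
      using mult_mono[of "real m" "real n + real m" 1 "real d"] \<open>1 \<le> d\<close> by simp
    have "?T \<le> A * ((n + m) * d)"
      unfolding A_def Let_def using \<open>1 \<le> d\<close> \<open>1 \<le> m\<close> params by (intro preprocess_cost_le)
    then have "time \<le> A * ((n + m) * d) + sort_cost cm m" using time by linarith
    then have "real time \<le> real (A * ((n + m) * d) + sort_cost cm m)" by (simp only: of_nat_le_iff)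
    also have "\<dots> = real A * ((real n + real m) * real d) + real (sort_cost cm m)" by simp
    also have "\<dots> \<le> real A * ((real n + real m) * real d + ?L)
        + C * ((real n + real m) * real d + ?L)"
    proof (rule add_mono)
      show "real A * ((real n + real m) * real d) \<le> real A * ((real n + real m) * real d + ?L)"
        using \<open>0 \<le> ?L\<close> by (intro mult_left_mono) auto
      have "C * (real m + ?L) \<le> C * ((real n + real m) * real d + ?L)"
        using \<open>real m \<le> _\<close> \<open>0 < C\<close> by (intro mult_left_mono) auto
      with C(2)[OF \<open>1 \<le> m\<close>]
      show "real (sort_cost cm m) \<le> C * ((real n + real m) * real d + ?L)" by linarith
    qed
    finally show "real time \<le> (real A + C) * ((real n + real m) * real d + ?L)"
      by (simp only: distrib_right)
  qed
  show ?thesis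
  proof (intro exI[of _ "real A + C"] conjI)
    show "0 < real A + C" using C(1) by simp
  qed (clarify, rule main; (assumption | simp))
qed

end
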